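(* Let $F_0:[0,\infty)\to[0,\infty)$ be a Lipschitz function with $0\le F_0(x)\le x$ for all $x\ge0$, with $F_0$ sublinear and $0\le\partial_xF_0\le1$ a.e. on $[0,\infty)$. Assume that $$\lim_{x\to\infty}\frac{F_0(x)}{x^{2/3}}=\infty.$$ Let $F$ be the unique viscosity solution of $$\begin{cases}\partial_tF+\tfrac12(\partial_xF-1)(\partial_xF-2)+\dfrac Fx-1=0&\text{in }(0,\infty)^2,\\ 0\le F(x,t)\le x&\text{on }[0,\infty)^2,\\ F(x,0)=F_0(x)&\text{on }[0,\infty).\end{cases}$$ Then, as $t\to\infty$, $F(x,t)\to x$ locally uniformly for $x\in[0,\infty)$.
   Context: A function $g$ on $[0,\infty)$ is sublinear if $\lim_{x\to\infty}g(x)/x=0$. Solutions are continuous on $[0,\infty)^2$ and are understood in the viscosity sense, with $F=F(x,t)$, $x$ the space variable and $t$ the time variable. Under the stated assumptions on $F_0$ (namely $0\le F_0(x)\le x$, sublinearity, $0\le\partial_xF_0\le1$), the problem has a unique (sublinear in $x$) viscosity solution $F$, which is known to be globally Lipschitz and to satisfy $0\le\partial_xF\le1$ a.e. on $[0,\infty)^2$. Locally uniformly means uniformly on compact subsets of $[0,\infty)$. *)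

theory Defs
  imports "HOL-Analysis.Analysis"
begin

definition sublinear :: "(real \<Rightarrow> real) \<Rightarrow> bool" where
  "sublinear g \<longleftrightarrow> ((\<lambda>x. g x / x) \<longlongrightarrow> 0) at_top"

text \<open>Points of the plane are pairs \<open>(x, t)\<close> with \<open>x\<close> the space and \<open>t\<close> the time variable.
  \<open>C1_with_partials S \<phi> \<phi>x \<phi>t\<close>: on the open set \<open>S\<close>, \<open>\<phi>\<close> is continuously differentiable with
  partial derivatives \<open>\<phi>x\<close> and \<open>\<phi>t\<close>.\<close>

definition C1_with_partials ::
  "(real \<times> real) set \<Rightarrow> (real \<times> real \<Rightarrow> real) \<Rightarrow> (real \<times> real \<Rightarrow> real) \<Rightarrow> (real \<times> real \<Rightarrow> real) \<Rightarrow> bool"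
where
  "C1_with_partials S \<phi> \<phi>x \<phi>t \<longleftrightarrow>
     (\<forall>z\<in>S. (\<phi> has_derivative (\<lambda>h. \<phi>x z * fst h + \<phi>t z * snd h)) (at z)) \<and>
     continuous_on S \<phi>x \<and> continuous_on S \<phi>t"

text \<open>Viscosity sub- and supersolutions on an open set \<open>S\<close> of the first-order equation
  \<open>G z (u z) (\<partial>\<^sub>x u z) (\<partial>\<^sub>t u z) = 0\<close>, tested by \<open>C\<^sup>1\<close> functions at local extrema of \<open>u - \<phi>\<close>.\<close>

definition viscosity_subsolution ::
  "(real \<times> real \<Rightarrow> real \<Rightarrow> real \<Rightarrow> real \<Rightarrow> real) \<Rightarrow> (real \<times> real) set \<Rightarrow> (real \<times> real \<Rightarrow> real) \<Rightarrow> bool"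
where
  "viscosity_subsolution G S u \<longleftrightarrow>
     (\<forall>\<phi> \<phi>x \<phi>t. \<forall>z\<in>S. C1_with_partials S \<phi> \<phi>x \<phi>t \<longrightarrow>
        (\<forall>\<^sub>F w in nhds z. u w - \<phi> w \<le> u z - \<phi> z) \<longrightarrow> G z (u z) (\<phi>x z) (\<phi>t z) \<le> 0)"

definition viscosity_supersolution ::
  "(real \<times> real \<Rightarrow> real \<Rightarrow> real \<Rightarrow> real \<Rightarrow> real) \<Rightarrow> (real \<times> real) set \<Rightarrow> (real \<times> real \<Rightarrow> real) \<Rightarrow> bool"
where
  "viscosity_supersolution G S u \<longleftrightarrow>
     (\<forall>\<phi> \<phi>x \<phi>t. \<forall>z\<in>S. C1_with_partials S \<phi> \<phi>x \<phi>t \<longrightarrow>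
        (\<forall>\<^sub>F w in nhds z. u w - \<phi> w \<ge> u z - \<phi> z) \<longrightarrow> G z (u z) (\<phi>x z) (\<phi>t z) \<ge> 0)"

definition viscosity_solution ::
  "(real \<times> real \<Rightarrow> real \<Rightarrow> real \<Rightarrow> real \<Rightarrow> real) \<Rightarrow> (real \<times> real) set \<Rightarrow> (real \<times> real \<Rightarrow> real) \<Rightarrow> bool"
where
  "viscosity_solution G S u \<longleftrightarrow> viscosity_subsolution G S u \<and> viscosity_supersolution G S u"

end

theory Submission
  imports Defs
begin

text \<open>
  Expanding the product, the equation reads \<open>F\<^sub>t + F\<^sub>x\<^sup>2/2 - 3/2 F\<^sub>x + F/x = 0\<close>, and \<open>F(x,t) = x\<close> solves it.
  As \<open>F \<le> x\<close>, it remains to bound \<open>F\<close> from below, which is done by explicit classical subsolutions.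

  For small slopes the equation is close to its linear part, whose stationary solutions are the
  multiples of \<open>x\<^bsup>2/3\<^esup>\<close>; this is where the exponent in the growth assumption comes from.
  The nonlinear equation has a one-parameter family of concave stationary solutions, obtained from
  one another by scaling, which behave like \<open>x\<close> near the origin and like a multiple of
  \<open>x\<^bsup>2/3\<^esup>\<close> at infinity, and which increase to \<open>x\<close> as that multiple grows. They are given only
  implicitly, but the function \<open>profile k\<close> below has the same behaviour and is an explicit
  stationary subsolution (\<open>profile_subsolution\<close>).

  By the growth assumption \<open>F\<^sub>0\<close> lies above \<open>profile k\<close> outside a bounded interval, for every \<open>k\<close>.
  What is missing on this interval is subtracted as a wave \<open>A exp(-a(x + t/4))\<close>. The characteristic
  speed is \<open>F\<^sub>x - 3/2 \<le> -1/2\<close> for slopes at most one, so disturbances are swept out through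
  \<open>x = 0\<close>; a sufficiently flat wave of speed \<open>-1/4\<close> therefore keeps the subsolution property
  (\<open>barrier_subsolution\<close>) and disappears as \<open>t \<rightarrow> \<infinity>\<close>. A further term \<open>\<delta>(x + 2t)\<close>
  makes the barrier nonpositive outside a bounded set of space-time. A comparison between \<open>F\<close> and the
  barrier then only involves an interior minimum of their difference, where the barrier itself is
  an admissible test function (\<open>classical_subsolution_le\<close>).
  Letting \<open>\<delta> \<rightarrow> 0\<close>, then \<open>t \<rightarrow> \<infinity>\<close>, then \<open>k \<rightarrow> \<infinity>\<close> gives the theorem.
\<close>

section \<open>Comparison with classical subsolutions\<close>

text \<open>As \<open>v \<le> u\<close> on the boundary and outside a bounded box, a violation forces a
  negative minimum of \<open>u - v\<close> at an interior point. There \<open>v\<close> touches \<open>u\<close> from below up to a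
  constant, and strict monotonicity in the value \<open>r\<close> contradicts the supersolution inequality.\<close>

lemma classical_subsolution_le:
  fixes u v :: "real \<times> real \<Rightarrow> real"
  assumes super: "viscosity_supersolution G ({0<..} \<times> {0<..}) u"
    and mono: "\<And>z r s p q. z \<in> {0<..} \<times> {0<..} \<Longrightarrow> r < s \<Longrightarrow> G z r p q < G z s p q"
    and C1: "C1_with_partials ({0<..} \<times> {0<..}) v vx vt"
    and sub: "\<And>z. z \<in> {0<..} \<times> {0<..} \<Longrightarrow> G z (v z) (vx z) (vt z) \<le> 0"
    and cont_u: "continuous_on ({0..} \<times> {0..}) u"
    and cont_v: "continuous_on ({0..} \<times> {0..}) v"
    and space_boundary: "\<And>t. t \<ge> 0 \<Longrightarrow> v (0, t) \<le> u (0, t)"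
    and initial: "\<And>x. x \<ge> 0 \<Longrightarrow> v (x, 0) \<le> u (x, 0)"
    and outside: "\<And>x t. x \<ge> 0 \<Longrightarrow> t \<ge> 0 \<Longrightarrow> x \<ge> B \<or> t \<ge> B \<Longrightarrow> v (x, t) \<le> u (x, t)"
    and z: "z \<in> {0..} \<times> {0..}"
  shows "v z \<le> u z"
proof (rule ccontr)
  assume "\<not> v z \<le> u z"
  then have neg: "u z - v z < 0" by simp
  let ?Q = "{0..B} \<times> {0..B}"
  have zQ: "z \<in> ?Q"
    using z outside[of "fst z" "snd z"] neg by (cases z) force
  have "continuous_on ?Q (\<lambda>w. u w - v w)"
    by (intro continuous_on_diff continuous_on_subset[OF cont_u] continuous_on_subset[OF cont_v]) auto
  moreover have "compact ?Q" by (intro compact_Times compact_Icc)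
  moreover have "?Q \<noteq> {}" using zQ by blast
  ultimately have "\<exists>y\<in>?Q. \<forall>w\<in>?Q. u y - v y \<le> u w - v w"
    by (intro continuous_attains_inf)
  then obtain y where y: "y \<in> ?Q" and ymin: "\<And>w. w \<in> ?Q \<Longrightarrow> u y - v y \<le> u w - v w"
    by blast
  have yneg: "u y - v y < 0" using ymin[OF zQ] neg by simp
  have global: "u y - v y \<le> u w - v w" if "w \<in> {0<..} \<times> {0<..}" for w
  proof (cases "w \<in> ?Q")
    case False
    then have "v w \<le> u w" using that outside[of "fst w" "snd w"] by (cases w) force
    then show ?thesis using yneg by simp
  qed (rule ymin)
  obtain x t where xt: "y = (x, t)" by (cases y)
  have "x \<noteq> 0" "t \<noteq> 0"
    using y yneg space_boundary[of t] initial[of x] by (auto simp: xt)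
  then have yin: "y \<in> {0<..} \<times> {0<..}" using y by (auto simp: xt)
  have "open ({0<..} \<times> {0<..} :: (real \<times> real) set)" by (intro open_Times) auto
  then have "\<forall>\<^sub>F w in nhds y. w \<in> {0<..} \<times> {0<..}"
    using yin by (rule eventually_nhds_in_open)
  then have "\<forall>\<^sub>F w in nhds y. u w - v w \<ge> u y - v y"
    by (rule eventually_mono) (rule global)
  then have "G y (u y) (vx y) (vt y) \<ge> 0"
    using super C1 yin unfolding viscosity_supersolution_def by blast
  moreover have "G y (u y) (vx y) (vt y) < G y (v y) (vx y) (vt y)"
    using mono[OF yin] yneg by simp
  ultimately show False using sub[OF yin] by simp
qed

section \<open>An explicit stationary subsolution\<close>

text \<open>Stationary solutions \<open>S\<close>, parametrised by their slope \<open>p\<close>, satisfy \<open>S/x = (3p - p\<^sup>2)/2\<close> and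
  \<open>x = c(1 - p)/p\<^sup>3\<close>. Replacing the second relation by the explicitly solvable
  \<open>x = k\<^sup>3 (1 - p)\<^sup>3/p\<^sup>3\<close>, which keeps the decay of order \<open>x\<^bsup>-1/3\<^esup>\<close> of \<open>p\<close>, gives
  \<open>profile_param\<close>, which is then no longer exactly the slope of \<open>profile\<close> but a lower bound for it.\<close>

definition profile_param :: "real \<Rightarrow> real \<Rightarrow> real" where
  "profile_param k x = k / (k + root 3 x)"

definition profile :: "real \<Rightarrow> real \<Rightarrow> real" where
  "profile k x = x * (3 * profile_param k x - (profile_param k x)\<^sup>2) / 2"

definition profile_slope :: "real \<Rightarrow> real \<Rightarrow> real" where
  "profile_slope k x = profile_param k x + (profile_param k x)\<^sup>2 * (1 - profile_param k x) / 3"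

lemma profile_param_bounds:
  assumes "k > 0" "x \<ge> 0"
  shows "0 < profile_param k x" "profile_param k x \<le> 1"
proof -
  have r: "root 3 x \<ge> 0" using assms by simp
  with assms have kr: "k + root 3 x > 0" by linarith
  show "0 < profile_param k x"
    unfolding profile_param_def using assms(1) kr by (rule divide_pos_pos)
  show "profile_param k x \<le> 1"
    unfolding profile_param_def using kr r by (subst divide_le_eq_1_pos) auto
qed

lemma profile_slope_bounds:
  assumes "k > 0" "x \<ge> 0"
  shows "profile_param k x \<le> profile_slope k x" "profile_slope k x \<le> 1"
proof -
  note p = profile_param_bounds[OF assms]
  show "profile_param k x \<le> profile_slope k x" using p by (simp add: profile_slope_def)
  have "(profile_param k x)\<^sup>2 * (1 - profile_param k x) \<le> 1 * (1 - profile_param k x)"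
    using p by (intro mult_right_mono power_le_one) auto
  then show "profile_slope k x \<le> 1" using p by (simp add: profile_slope_def)
qed

lemma continuous_on_profile:
  assumes "k > 0"
  shows "continuous_on {0..} (profile k)"
proof -
  have "k + root 3 x \<noteq> 0" if "x \<in> {0..}" for x
    using assms that real_root_ge_zero[of x 3] by (smt (verit) atLeast_iff)
  then show ?thesis
    unfolding profile_def profile_param_def by (intro continuous_intros) auto
qed

lemma continuous_on_profile_slope:
  assumes "k > 0"
  shows "continuous_on {0<..} (profile_slope k)"
proof -
  have "k + root 3 x \<noteq> 0" if "x \<in> {0<..}" for x
    using assms that real_root_gt_zero[of 3 x] by (smt (verit) greaterThan_iff zero_less_numeral)
  then show ?thesis
    unfolding profile_slope_def profile_param_def by (intro continuous_intros) auto
qed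

lemma profile_has_derivative:
  assumes k: "k > 0" and x: "x > 0"
  shows "(profile k has_real_derivative profile_slope k x) (at x)"
proof -
  define r where "r = root 3 x"
  define p where "p = profile_param k x"
  have r: "r > 0" using x by (simp add: r_def)
  have rx: "x = r ^ 3" using x by (simp add: r_def)
  have kr: "k + r > 0" using k r by simp
  have p_r: "p = k / (k + r)" by (simp add: p_def profile_param_def r_def)
  have root: "(root 3 has_real_derivative inverse (3 * r ^ 2)) (at x)"
    using DERIV_real_root[of 3 x] x by (simp add: r_def eval_nat_numeral)
  have "(profile_param k has_real_derivative - (k * inverse (3 * r ^ 2)) / (k + r)\<^sup>2) (at x)"
    unfolding profile_param_def
    using kr x by (auto intro!: derivative_eq_intros root simp: r_def[symmetric] power2_eq_square)
  \<comment> \<open>The choice of \<open>profile_param\<close> makes its logarithmic derivative \<open>-(1 - p)/(3x)\<close>.\<close>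
  moreover have "- (k * inverse (3 * r ^ 2)) / (k + r)\<^sup>2 = - (p * (1 - p)) / (3 * x)"
    using kr r unfolding p_r rx by (simp add: divide_simps) (simp add: algebra_simps eval_nat_numeral)
  ultimately have dp: "(profile_param k has_real_derivative - (p * (1 - p)) / (3 * x)) (at x)"
    by simp
  show ?thesis
    unfolding profile_def
    using x by (auto intro!: derivative_eq_intros dp simp: p_def[symmetric] profile_slope_def)
      (simp add: field_simps eval_nat_numeral)
qed

text \<open>The polynomial \<open>s\<^sup>2/2 - 3s/2 + profile k x / x\<close> in \<open>s\<close> has the roots \<open>p\<close> and
  \<open>3 - p\<close>, where \<open>p = profile_param k x\<close>; the slope lies between them.\<close>

lemma profile_subsolution:
  assumes k: "k > 0" and x: "x > 0"
  shows "1/2 * (profile_slope k x - 1) * (profile_slope k x - 2) + profile k x / x - 1 \<le> 0"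
proof -
  let ?p = "profile_param k x" and ?s = "profile_slope k x"
  have "0 \<le> (?s - ?p) * (3 - ?p - ?s)"
    using profile_param_bounds[OF k, of x] profile_slope_bounds[OF k, of x] x
    by (intro mult_nonneg_nonneg) auto
  moreover have "profile k x / x = (3 * ?p - ?p\<^sup>2) / 2"
    using x by (simp add: profile_def)
  moreover have "1/2 * (?s - 1) * (?s - 2) + (3 * ?p - ?p\<^sup>2) / 2 - 1 = - ((?s - ?p) * (3 - ?p - ?s)) / 2"
    by (simp add: field_simps power2_eq_square)
  ultimately show ?thesis by linarith
qed

lemma profile_le: "profile k x \<le> x" if "k > 0" "x \<ge> 0"
proof -
  have "0 \<le> (1 - profile_param k x) * (2 - profile_param k x)"
    using profile_param_bounds[OF that] by (intro mult_nonneg_nonneg) auto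
  then have "(3 * profile_param k x - (profile_param k x)\<^sup>2) / 2 \<le> 1"
    by (simp add: algebra_simps power2_eq_square)
  from mult_left_mono[OF this \<open>x \<ge> 0\<close>] show ?thesis by (simp add: profile_def)
qed

lemma profile_le_root:
  assumes k: "k > 0" and x: "x > 0"
  shows "profile k x \<le> 3/2 * k * (root 3 x)\<^sup>2"
proof -
  define r where "r = root 3 x"
  have r: "r > 0" using x by (simp add: r_def)
  have rx: "x = r ^ 3" using x by (simp add: r_def)
  have "profile_param k x \<le> k / r"
    using k r by (simp add: profile_param_def r_def[symmetric] frac_le)
  moreover have "profile k x \<le> x * (3 * profile_param k x) / 2"
    using x by (simp add: profile_def)
  moreover have "x * (3 * profile_param k x) / 2 \<le> x * (3 * (k / r)) / 2"
    using x calculation(1) by (intro divide_right_mono mult_left_mono) auto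
  moreover have "x * (3 * (k / r)) / 2 = 3/2 * k * r\<^sup>2"
    using r by (simp add: rx eval_nat_numeral)
  ultimately show ?thesis by (simp add: r_def)
qed

text \<open>Since \<open>x - profile k x = x(1 - p)(2 - p)/2 \<le> x(1 - p)\<close> with \<open>p = profile_param k x\<close>, the profiles tend to
  the identity locally uniformly as \<open>k \<rightarrow> \<infinity>\<close>.\<close>

lemma profile_ge:
  assumes k: "k > 0" and x: "x \<ge> 0"
  shows "x - x * root 3 x / k \<le> profile k x"
proof -
  let ?p = "profile_param k x"
  note p = profile_param_bounds[OF assms]
  have r: "root 3 x \<ge> 0" using x by simp
  have kr: "k + root 3 x > 0" using k r by (rule add_pos_nonneg)
  have "1 - ?p = root 3 x / (k + root 3 x)"
    using kr by (simp add: profile_param_def field_simps)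
  also have "\<dots> \<le> root 3 x / k"
    using k r by (intro divide_left_mono) (auto intro: mult_pos_pos kr)
  finally have "1 - ?p \<le> root 3 x / k" .
  moreover have "0 \<le> ?p * (1 - ?p)" using p by simp
  ultimately have "1 - root 3 x / k \<le> (3 * ?p - ?p\<^sup>2) / 2"
    by (simp add: algebra_simps power2_eq_square)
  from mult_left_mono[OF this x] show ?thesis by (simp add: profile_def algebra_simps)
qed

section \<open>The time-dependent barrier\<close>

definition barrier :: "real \<Rightarrow> real \<Rightarrow> real \<Rightarrow> real \<Rightarrow> real \<times> real \<Rightarrow> real" where
  "barrier k A a \<delta> = (\<lambda>(x, t). profile k x - A * exp (- a * (x + t / 4)) - \<delta> * (x + 2 * t))"

definition barrier_x :: "real \<Rightarrow> real \<Rightarrow> real \<Rightarrow> real \<Rightarrow> real \<times> real \<Rightarrow> real" where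
  "barrier_x k A a \<delta> = (\<lambda>(x, t). profile_slope k x + a * A * exp (- a * (x + t / 4)) - \<delta>)"

definition barrier_t :: "real \<Rightarrow> real \<Rightarrow> real \<Rightarrow> real \<times> real \<Rightarrow> real" where
  "barrier_t A a \<delta> = (\<lambda>(x, t). a * A * exp (- a * (x + t / 4)) / 4 - 2 * \<delta>)"

lemma barrier_C1:
  assumes k: "k > 0"
  shows "C1_with_partials ({0<..} \<times> {0<..}) (barrier k A a \<delta>) (barrier_x k A a \<delta>) (barrier_t A a \<delta>)"
  unfolding C1_with_partials_def
proof (intro conjI ballI)
  fix z :: "real \<times> real" assume z: "z \<in> {0<..} \<times> {0<..}"
  have "(profile k has_derivative (\<lambda>h. profile_slope k (fst z) * h)) (at (fst z))"
    using profile_has_derivative[OF k, of "fst z"] z by (auto simp: has_field_derivative_def)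
  from has_derivative_compose[OF has_derivative_fst[OF has_derivative_ident] this]
  have prof: "((\<lambda>w. profile k (fst w)) has_derivative (\<lambda>h. profile_slope k (fst z) * fst h)) (at z)"
    by simp
  have "((\<lambda>w. - a * (fst w + snd w / 4)) has_derivative (\<lambda>h. - a * (fst h + snd h / 4))) (at z)"
    by (intro has_derivative_mult_right has_derivative_add bounded_linear.has_derivative[OF bounded_linear_divide]
        has_derivative_fst has_derivative_snd has_derivative_ident)
  from has_derivative_mult_right[OF has_derivative_exp[OF this], of A]
  have wave: "((\<lambda>w. A * exp (- a * (fst w + snd w / 4))) has_derivative
      (\<lambda>h. A * (- a * (fst h + snd h / 4) * exp (- a * (fst z + snd z / 4))))) (at z)" .
  have lin: "((\<lambda>w. \<delta> * (fst w + 2 * snd w)) has_derivative (\<lambda>h. \<delta> * (fst h + 2 * snd h))) (at z)"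
    by (intro has_derivative_mult_right has_derivative_add has_derivative_fst
        has_derivative_snd has_derivative_ident)
  show "(barrier k A a \<delta> has_derivative
      (\<lambda>h. barrier_x k A a \<delta> z * fst h + barrier_t A a \<delta> z * snd h)) (at z)"
    unfolding barrier_def barrier_x_def barrier_t_def case_prod_beta
    by (rule has_derivative_eq_rhs[OF has_derivative_diff[OF has_derivative_diff[OF prof wave] lin]])
       (simp add: fun_eq_iff algebra_simps)
next
  have "continuous_on ({0<..} \<times> {0<..}) (\<lambda>w. profile_slope k (fst w))"
    by (rule continuous_on_compose2[OF continuous_on_profile_slope[OF k] continuous_on_fst])
       (auto intro: continuous_on_id)
  then show "continuous_on ({0<..} \<times> {0<..}) (barrier_x k A a \<delta>)"
    unfolding barrier_x_def case_prod_beta by (intro continuous_intros) auto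
  show "continuous_on ({0<..} \<times> {0<..}) (barrier_t A a \<delta>)"
    unfolding barrier_t_def case_prod_beta by (intro continuous_intros) auto
qed

lemma continuous_on_barrier:
  assumes k: "k > 0"
  shows "continuous_on ({0..} \<times> {0..}) (barrier k A a \<delta>)"
proof -
  have "continuous_on ({0..} \<times> {0..}) (\<lambda>w :: real \<times> real. profile k (fst w))"
    by (rule continuous_on_compose2[OF continuous_on_profile[OF k] continuous_on_fst])
       (auto intro: continuous_on_id)
  then show ?thesis
    unfolding barrier_def case_prod_beta by (intro continuous_intros) auto
qed

text \<open>Let \<open>m\<close> be the slope of the wave. Relative to the profile, the barrier
  changes the left-hand side by at most \<open>-m/4 + m\<^sup>2/2 - \<delta>/2 + \<delta>\<^sup>2/2\<close> because the profile
  has slope in \<open>[0, 1]\<close>; this is nonpositive for \<open>m \<le> 1/2\<close> and \<open>\<delta> \<le> 1\<close>.\<close>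

lemma barrier_subsolution:
  assumes k: "k > 0" and A: "A \<ge> 0" and a: "a \<ge> 0" and aA: "a * A \<le> 1/2"
    and \<delta>: "0 \<le> \<delta>" "\<delta> \<le> 1" and x: "x > 0" and t: "t > 0"
  shows "barrier_t A a \<delta> (x, t)
      + 1/2 * (barrier_x k A a \<delta> (x, t) - 1) * (barrier_x k A a \<delta> (x, t) - 2)
      + barrier k A a \<delta> (x, t) / x - 1 \<le> 0"
proof -
  define e where "e = exp (- a * (x + t / 4))"
  define m where "m = a * A * e"
  define s where "s = profile_slope k x"
  have e: "0 < e" "e \<le> 1" using a x t by (auto simp: e_def)
  have m0: "0 \<le> m" using a A e by (simp add: m_def)
  have "m \<le> 1/2 * 1" unfolding m_def using aA a A e by (intro mult_mono) auto
  then have m: "m * (1/2 - m) \<ge> 0" using m0 by simp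
  have s: "0 \<le> s" "s \<le> 1"
    using profile_param_bounds[OF k, of x] profile_slope_bounds[OF k, of x] x by (auto simp: s_def)
  have base: "1/2 * (s - 1) * (s - 2) + profile k x / x - 1 \<le> 0"
    using profile_subsolution[OF k x] by (simp add: s_def)
  have sub: "0 \<le> (A * e + \<delta> * (x + 2 * t)) / x"
    using A e \<delta> x t by (intro divide_nonneg_pos add_nonneg_nonneg mult_nonneg_nonneg) auto
  have val: "barrier k A a \<delta> (x, t) / x = profile k x / x - (A * e + \<delta> * (x + 2 * t)) / x"
    by (simp add: barrier_def e_def diff_divide_distrib add_divide_distrib)
  have x': "barrier_x k A a \<delta> (x, t) = s + m - \<delta>" by (simp add: barrier_x_def s_def m_def e_def)
  have t': "barrier_t A a \<delta> (x, t) = m / 4 - 2 * \<delta>" by (simp add: barrier_t_def m_def e_def)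
  have sm: "0 \<le> (1 - s) * m" and s\<delta>: "0 \<le> s * \<delta>" and m\<delta>: "0 \<le> m * \<delta>" and \<delta>\<delta>: "0 \<le> \<delta> * (1 - \<delta>)"
    using s m0 \<delta> by simp_all
  have "m / 4 - 2 * \<delta> + 1/2 * (s + m - \<delta> - 1) * (s + m - \<delta> - 2)
      = 1/2 * (s - 1) * (s - 2)
        - (1 - s) * m - s * \<delta> - m * \<delta> - \<delta> * (1 - \<delta>) / 2 - m * (1/2 - m) / 2"
    by (simp add: field_simps)
  then show ?thesis
    unfolding val x' t' using base sub m sm s\<delta> m\<delta> \<delta>\<delta> by linarith
qed

text \<open>The linear term dominates the sublinear profile for large \<open>x\<close>, and also for large \<open>t\<close> as
  \<open>profile k x - \<delta>x\<close> is bounded above.\<close>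

lemma barrier_nonpos_outside_box:
  assumes k: "k > 0" and A: "A \<ge> 0" and \<delta>: "\<delta> > 0"
  obtains B where "\<And>x t. x \<ge> 0 \<Longrightarrow> t \<ge> 0 \<Longrightarrow> x \<ge> B \<or> t \<ge> B \<Longrightarrow> barrier k A a \<delta> (x, t) \<le> 0"
proof
  \<comment> \<open>Beyond \<open>c\<^sup>3\<close> the bound \<open>3/2 k x\<^bsup>2/3\<^esup>\<close> on the profile is at most \<open>\<delta>x\<close>.\<close>
  define c where "c = 3 * k / (2 * \<delta>)"
  have c: "c > 0" using k \<delta> by (simp add: c_def)
  fix x t :: real
  assume x: "x \<ge> 0" and t: "t \<ge> 0" and B: "x \<ge> max (c ^ 3) (c ^ 3 / (2 * \<delta>)) \<or> t \<ge> max (c ^ 3) (c ^ 3 / (2 * \<delta>))"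
  have "profile k x \<le> \<delta> * (x + 2 * t)"
  proof (cases "x \<ge> c ^ 3")
    case True
    define r where "r = root 3 x"
    have x0: "x > 0" using True c by (meson less_le_trans zero_less_power)
    have "root 3 (c ^ 3) \<le> root 3 x" using True by simp
    then have cr: "c \<le> r" using c by (simp add: r_def real_root_power_cancel)
    have "profile k x \<le> 3/2 * k * r\<^sup>2" using profile_le_root[OF k x0] by (simp add: r_def)
    also have "\<dots> = \<delta> * (c * r\<^sup>2)" using \<delta> by (simp add: c_def)
    also have "\<dots> \<le> \<delta> * (r * r\<^sup>2)" using cr \<delta> by (intro mult_left_mono mult_right_mono) auto
    also have "r * r\<^sup>2 = x" using x0 by (simp add: r_def power2_eq_square flip: power3_eq_cube)
        (metis mult.assoc power3_eq_cube odd_real_root_pow odd_numeral)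
    finally show ?thesis using \<delta> t by (simp add: algebra_simps add_increasing2)
  next
    case False
    then have "t \<ge> c ^ 3 / (2 * \<delta>)" using B by auto
    then have "c ^ 3 \<le> \<delta> * (2 * t)" using \<delta> by (simp add: field_simps)
    moreover have "profile k x \<le> c ^ 3" using profile_le[OF k x] False by simp
    moreover have "0 \<le> \<delta> * x" using \<delta> x by simp
    ultimately show ?thesis by (simp add: algebra_simps)
  qed
  moreover have "0 \<le> A * exp (- a * (x + t / 4))" using A by simp
  ultimately show "barrier k A a \<delta> (x, t) \<le> 0" by (simp add: barrier_def)
qed

section \<open>Long-time behaviour\<close>

text \<open>The wave amplitude \<open>A = eR\<close> and rate \<open>a = 1/(2eR)\<close> make the barrier lie below the
  initial value on \<open>[0, R]\<close>, where \<open>F\<^sub>0\<close> may vanish, while \<open>aA = 1/2\<close> is the largest slope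
  admitted by \<open>barrier_subsolution\<close>. Neither depends on \<open>\<delta>\<close>, which can thus be sent to zero.\<close>

lemma solution_above_wave:
  fixes F :: "real \<times> real \<Rightarrow> real"
  assumes k: "k > 0"
    and cont: "continuous_on ({0..} \<times> {0..}) F"
    and super: "viscosity_supersolution
      (\<lambda>(x, t) r p q. q + 1/2 * (p - 1) * (p - 2) + r / x - 1) ({0<..} \<times> {0<..}) F"
    and nonneg: "\<And>x t. x \<ge> 0 \<Longrightarrow> t \<ge> 0 \<Longrightarrow> 0 \<le> F (x, t)"
    and growth: "filterlim (\<lambda>x. F0 x / x powr (2/3)) at_top at_top"
    and initial: "\<And>x. x \<ge> 0 \<Longrightarrow> F (x, 0) = F0 x"
  obtains A a where "A \<ge> 0" "a > 0"
    "\<And>x t. x \<ge> 0 \<Longrightarrow> t \<ge> 0 \<Longrightarrow> profile k x - A * exp (- a * (x + t / 4)) \<le> F (x, t)"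
proof -
  let ?G = "\<lambda>(x, t) r p q. q + 1/2 * (p - 1) * (p - 2) + r / x - 1 :: real"
  have "\<forall>\<^sub>F x in at_top. 3/2 * k \<le> F0 x / x powr (2/3)"
    using growth unfolding filterlim_at_top by (rule spec)
  then obtain R0 where R0: "\<And>x. x \<ge> R0 \<Longrightarrow> 3/2 * k \<le> F0 x / x powr (2/3)"
    by (auto simp: eventually_at_top_linorder)
  define R where "R = max R0 1"
  have R: "R \<ge> 1" by (simp add: R_def)
  \<comment> \<open>On \<open>[0, R]\<close> the profile is at most \<open>R\<close> and \<open>ax \<le> 1\<close>, so the factor \<open>e\<close> makes the wave at
    least \<open>R\<close> there.\<close>
  define A where "A = exp 1 * R"
  define a where "a = 1 / (2 * A)"
  have A: "A > 0" using R by (simp add: A_def)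
  have a: "a > 0" using A by (simp add: a_def)
  have aA: "a * A \<le> 1/2" using A by (simp add: a_def)
  have aR: "a * R \<le> 1" using R exp_ge_add_one_self[of 1] by (simp add: a_def A_def)
  have start: "profile k x - A * exp (- a * x) \<le> F (x, 0)" if x: "x \<ge> 0" for x
  proof (cases "x \<ge> R")
    case True
    then have x1: "x \<ge> R0" "x > 0" using R by (auto simp: R_def)
    have "(root 3 x)\<^sup>2 = (x powr (1/3)) powr 2"
      using x1 by (simp add: root_powr_inverse powr_numeral)
    also have "\<dots> = x powr (2/3)" by (simp add: powr_powr)
    finally have "profile k x \<le> 3/2 * k * x powr (2/3)"
      using profile_le_root[OF k x1(2)] by simp
    also have "\<dots> \<le> F0 x" using R0[OF x1(1)] x1 by (simp add: pos_le_divide_eq)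
    finally have "profile k x \<le> F (x, 0)" using initial[OF x] by simp
    moreover have "0 \<le> A * exp (- a * x)" using A by simp
    ultimately show ?thesis by linarith
  next
    case False
    then have "a * x \<le> a * R" using a by (intro mult_left_mono) auto
    then have "exp (- 1) \<le> exp (- a * x)" using aR by simp
    then have "A * exp (- 1) \<le> A * exp (- a * x)" using A by (intro mult_left_mono) auto
    moreover have "A * exp (- 1) = R" by (simp add: A_def exp_minus)
    moreover have "profile k x \<le> R" using profile_le[OF k x] False by simp
    ultimately show ?thesis using nonneg[OF x, of 0] by simp
  qed
  have below: "barrier k A a \<delta> z \<le> F z" if \<delta>: "0 < \<delta>" "\<delta> \<le> 1" and z: "z \<in> {0..} \<times> {0..}" for \<delta> z
  proof -
    obtain B where B: "\<And>x t. x \<ge> 0 \<Longrightarrow> t \<ge> 0 \<Longrightarrow> x \<ge> B \<or> t \<ge> B \<Longrightarrow> barrier k A a \<delta> (x, t) \<le> 0"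
      using barrier_nonpos_outside_box[OF k _ \<delta>(1)] A by (metis less_imp_le)
    show ?thesis
    proof (rule classical_subsolution_le[where B = B, OF super _ barrier_C1[OF k] _ cont
          continuous_on_barrier[OF k] _ _ _ z])
      fix y :: "real \<times> real" and r s p q :: real
      assume "y \<in> {0<..} \<times> {0<..}" "r < s"
      then show "?G y r p q < ?G y s p q" by (auto simp: divide_strict_right_mono)
    next
      fix y :: "real \<times> real" assume y: "y \<in> {0<..} \<times> {0<..}"
      obtain x t where xt: "y = (x, t)" by (cases y)
      with y have "x > 0" "t > 0" by simp_all
      from barrier_subsolution[OF k _ _ aA less_imp_le[OF \<delta>(1)] \<delta>(2) this] A a
      show "?G y (barrier k A a \<delta> y) (barrier_x k A a \<delta> y) (barrier_t A a \<delta> y) \<le> 0"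
        unfolding xt case_prod_conv by (meson less_imp_le)
    next
      fix t :: real assume t: "t \<ge> 0"
      have "0 \<le> A * exp (- a * (0 + t / 4))" "0 \<le> \<delta> * (0 + 2 * t)" using A \<delta> t by simp_all
      then have "barrier k A a \<delta> (0, t) \<le> 0" by (simp add: barrier_def profile_def)
      then show "barrier k A a \<delta> (0, t) \<le> F (0, t)" using nonneg[of 0 t] t by simp
    next
      fix x :: real assume x: "x \<ge> 0"
      have "0 \<le> \<delta> * x" using \<delta> x by simp
      then show "barrier k A a \<delta> (x, 0) \<le> F (x, 0)" using start[OF x] by (simp add: barrier_def)
    next
      fix x t :: real assume "x \<ge> 0" "t \<ge> 0" "x \<ge> B \<or> t \<ge> B"
      then show "barrier k A a \<delta> (x, t) \<le> F (x, t)" using B[of x t] nonneg[of x t] by linarith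
    qed
  qed
  have "profile k x - A * exp (- a * (x + t / 4)) \<le> F (x, t)" if "x \<ge> 0" "t \<ge> 0" for x t
  proof (rule tendsto_upperbound)
    have "((\<lambda>\<delta>. barrier k A a \<delta> (x, t)) \<longlongrightarrow> barrier k A a 0 (x, t)) (at_right 0)"
      unfolding barrier_def by (auto intro!: tendsto_eq_intros)
    then show "((\<lambda>\<delta>. barrier k A a \<delta> (x, t)) \<longlongrightarrow> profile k x - A * exp (- a * (x + t / 4))) (at_right 0)"
      by (simp add: barrier_def)
    have "\<forall>\<^sub>F \<delta> in at_right (0::real). \<delta> \<in> {0<..<1}"
      by (rule eventually_at_right_real) simp
    then show "\<forall>\<^sub>F \<delta> in at_right 0. barrier k A a \<delta> (x, t) \<le> F (x, t)"
      by (rule eventually_mono) (use below that in auto)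
  qed simp
  then show thesis by (rule that[OF less_imp_le[OF A] a])
qed

theorem theorem1p5:
  fixes F0 :: "real \<Rightarrow> real" and F :: "real \<times> real \<Rightarrow> real"
  assumes F0_lipschitz: "\<exists>L. L-lipschitz_on {0..} F0"
    and F0_bounds: "\<And>x. x \<ge> 0 \<Longrightarrow> 0 \<le> F0 x \<and> F0 x \<le> x"
    and F0_sublinear: "sublinear F0"
    and F0_deriv: "AE x in lebesgue_on {0..}.
          \<exists>D. (F0 has_real_derivative D) (at x within {0..}) \<and> 0 \<le> D \<and> D \<le> 1"
    and F0_growth: "filterlim (\<lambda>x. F0 x / x powr (2/3)) at_top at_top"
    and F_continuous: "continuous_on ({0..} \<times> {0..}) F"
    and F_sublinear: "\<And>t. t \<ge> 0 \<Longrightarrow> sublinear (\<lambda>x. F (x, t))"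
    and F_equation: "viscosity_solution
          (\<lambda>(x, t) r p q. q + 1/2 * (p - 1) * (p - 2) + r / x - 1) ({0<..} \<times> {0<..}) F"
    and F_bounds: "\<And>x t. x \<ge> 0 \<Longrightarrow> t \<ge> 0 \<Longrightarrow> 0 \<le> F (x, t) \<and> F (x, t) \<le> x"
    and F_initial: "\<And>x. x \<ge> 0 \<Longrightarrow> F (x, 0) = F0 x"
  shows "\<forall>K. compact K \<and> K \<subseteq> {0..} \<longrightarrow>
           uniform_limit K (\<lambda>t x. F (x, t)) (\<lambda>x. x) at_top"
proof (intro allI impI)
  fix K :: "real set"
  assume K: "compact K \<and> K \<subseteq> {0..}"
  obtain M where M: "M > 0" "\<And>x. x \<in> K \<Longrightarrow> x \<le> M"
    using compact_imp_bounded[of K] K bounded_pos[of K] by (metis abs_le_D1 real_norm_def)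
  show "uniform_limit K (\<lambda>t x. F (x, t)) (\<lambda>x. x) at_top"
  proof (rule uniform_limitI)
    fix \<epsilon> :: real assume \<epsilon>: "\<epsilon> > 0"
    \<comment> \<open>With this \<open>k\<close> the profile is within \<open>\<epsilon>/2\<close> of the identity on \<open>[0, M]\<close>.\<close>
    define k where "k = 2 * M * root 3 M / \<epsilon>"
    have k: "k > 0" using M \<epsilon> by (simp add: k_def)
    have super: "viscosity_supersolution
        (\<lambda>(x, t) r p q. q + 1/2 * (p - 1) * (p - 2) + r / x - 1) ({0<..} \<times> {0<..}) F"
      using F_equation unfolding viscosity_solution_def by (rule conjunct2)
    have nonneg: "0 \<le> F (x, t)" if "x \<ge> 0" "t \<ge> 0" for x t using F_bounds[OF that] by (rule conjunct1)
    obtain A a where A: "A \<ge> 0" and a: "a > 0"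
      and lower: "\<And>x t. x \<ge> 0 \<Longrightarrow> t \<ge> 0 \<Longrightarrow> profile k x - A * exp (- a * (x + t / 4)) \<le> F (x, t)"
      using solution_above_wave[OF k F_continuous super nonneg F0_growth F_initial] by blast
    have "filterlim (\<lambda>t. - a / 4 * t) at_bot at_top"
      using a by (intro filterlim_tendsto_neg_mult_at_bot[OF tendsto_const] filterlim_ident) auto
    from tendsto_mult_left[OF filterlim_compose[OF exp_at_bot this], of A]
    have "((\<lambda>t. A * exp (- a * (t / 4))) \<longlongrightarrow> 0) at_top" by simp
    then have "\<forall>\<^sub>F t in at_top. A * exp (- a * (t / 4)) < \<epsilon> / 2"
      using \<epsilon> by (intro order_tendstoD(2)) auto
    then show "\<forall>\<^sub>F t in at_top. \<forall>x\<in>K. dist (F (x, t)) x < \<epsilon>"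
      using eventually_ge_at_top[of 0]
    proof eventually_elim
      case (elim t)
      show ?case
      proof
        fix x assume "x \<in> K"
        then have x: "0 \<le> x" "x \<le> M" using K M by auto
        have "x * root 3 x \<le> M * root 3 M" using x by (intro mult_mono) auto
        then have "x * root 3 x / k \<le> M * root 3 M / k" using k by (intro divide_right_mono) auto
        also have "\<dots> = \<epsilon> / 2" using M \<epsilon> by (simp add: k_def)
        finally have "x - \<epsilon> / 2 \<le> profile k x" using profile_ge[OF k x(1)] by linarith
        moreover have "A * exp (- a * (x + t / 4)) \<le> A * exp (- a * (t / 4))"
          using A a x by (intro mult_left_mono) auto
        ultimately show "dist (F (x, t)) x < \<epsilon>"
          using lower[of x t] F_bounds[of x t] x elim by (simp add: dist_real_def)
      qed
    qed
  qed
qed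

end
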